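(* Let $X$ be a finite or countable set with $|X|\ge 3$ and $\varphi$ a coloring on $X$. The following are equivalent: (i) there are a coloring $\psi$ on $X$ and a point $x\in X$ such that $\mathrm{hom}(\varphi)=\mathrm{hom}(\psi)$, $\varphi\ne\psi$, and $\varphi|(X\setminus\{x\})=\psi|(X\setminus\{x\})$; (ii) there is a critical pair for $\varphi$.
   Context: A coloring on a set $X$ is a function $\varphi:[X]^2\to\{0,1\}$, where $[X]^2$ is the set of $2$-element subsets of $X$; for $Y\subseteq X$, $\varphi|Y$ is the restriction to $[Y]^2$. $\mathrm{hom}(\varphi)=\{H\subseteq X:\ |H|>2 \text{ and } \varphi \text{ is constant on } [H]^2\}$. A pair $\{x,y\}\in[X]^2$ is critical for $\varphi$ if $\varphi(\{x,z\})=1-\varphi(\{y,z\})$ for all $z\in X\setminus\{x,y\}$. *)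

theory Defs
  imports "HOL-Library.Ramsey" "HOL-Library.Countable_Set"
begin

(* The extensional function space makes equality of colorings on X mean equality on [X]^2. *)
definition colorings :: "'a set \<Rightarrow> ('a set \<Rightarrow> nat) set"
  where "colorings X = ([X]\<^bsup>2\<^esup> \<rightarrow>\<^sub>E {0, 1})"

definition col_restrict :: "('a set \<Rightarrow> nat) \<Rightarrow> 'a set \<Rightarrow> 'a set \<Rightarrow> nat"
  where "col_restrict \<phi> Y = restrict \<phi> ([Y]\<^bsup>2\<^esup>)"

(* card of an infinite set is 0, hence the separate disjunct for |H| > 2. *)
definition hom :: "'a set \<Rightarrow> ('a set \<Rightarrow> nat) \<Rightarrow> 'a set set"
  where "hom X \<phi> =
    {H. H \<subseteq> X \<and> (infinite H \<or> card H > 2) \<and> (\<exists>c. \<forall>e \<in> [H]\<^bsup>2\<^esup>. \<phi> e = c)}"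

definition critical_pair :: "'a set \<Rightarrow> ('a set \<Rightarrow> nat) \<Rightarrow> 'a \<Rightarrow> 'a \<Rightarrow> bool"
  where "critical_pair X \<phi> x y \<longleftrightarrow>
    {x, y} \<in> [X]\<^bsup>2\<^esup> \<and> (\<forall>z \<in> X - {x, y}. \<phi> {x, z} = 1 - \<phi> {y, z})"

end

(* Homogeneity of a three-element set is what hom sees of a coloring. Let D be the set of y at which
   the two colorings differ on {x, y}. If y is in D and w is not, the triangle x, y, w forces the
   colors of {x, w} and {y, w} to differ; if y and z are both in D, the triangle x, y, z forces the
   colors of {x, y} and {x, z} to differ. So D has at most two points, and x together with one
   of them is critical. Conversely, no homogeneous set contains a critical pair, so the color
   of that pair can be flipped without changing hom. *)
theory Submission
  imports Defs
begin

lemma pair_in_nsets_iff: "{a, b} \<in> [X]\<^bsup>2\<^esup> \<longleftrightarrow> a \<in> X \<and> b \<in> X \<and> a \<noteq> b"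
  by (auto simp: nsets_def card_insert_if)

lemma nsets_2_triple:
  assumes "a \<noteq> b" "a \<noteq> c" "b \<noteq> c"
  shows "[{a, b, c}]\<^bsup>2\<^esup> = {{a, b}, {a, c}, {b, c}}"
proof (intro set_eqI iffI)
  fix e assume "e \<in> [{a, b, c}]\<^bsup>2\<^esup>"
  then obtain u v where "e = {u, v}" "u \<in> {a, b, c}" "v \<in> {a, b, c}" "u \<noteq> v"
    by (auto simp: nsets_2_eq)
  then show "e \<in> {{a, b}, {a, c}, {b, c}}" by (auto simp: insert_commute)
next
  fix e assume "e \<in> {{a, b}, {a, c}, {b, c}}"
  then show "e \<in> [{a, b, c}]\<^bsup>2\<^esup>" using assms by (auto simp: pair_in_nsets_iff)
qed

lemma triple_in_hom_iff:
  assumes "a \<in> X" "b \<in> X" "c \<in> X" "a \<noteq> b" "a \<noteq> c" "b \<noteq> c"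
  shows "{a, b, c} \<in> hom X \<phi> \<longleftrightarrow> \<phi> {a, b} = \<phi> {a, c} \<and> \<phi> {a, b} = \<phi> {b, c}"
  using assms by (auto simp: hom_def nsets_2_triple)

lemma coloring_values:
  assumes "\<phi> \<in> colorings X" "a \<in> X" "b \<in> X" "a \<noteq> b"
  shows "\<phi> {a, b} = 0 \<or> \<phi> {a, b} = 1"
  using assms PiE_mem[of \<phi> "[X]\<^bsup>2\<^esup>" "\<lambda>_. {0, 1}" "{a, b}"]
  by (auto simp: colorings_def pair_in_nsets_iff)

text \<open>A homogeneous set has more than two points, so a third point z would make {x, z} and {y,
  z} equal in color, which criticality excludes.\<close>

lemma critical_pair_not_subset_hom:
  assumes "critical_pair X \<phi> x y" "H \<in> hom X \<phi>"
  shows "\<not> {x, y} \<subseteq> H"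
proof
  assume sub: "{x, y} \<subseteq> H"
  have "x \<noteq> y" "H \<subseteq> X"
    using assms by (auto simp: critical_pair_def hom_def pair_in_nsets_iff)
  have "H \<noteq> {x, y}" using assms(2) \<open>x \<noteq> y\<close> by (auto simp: hom_def)
  then obtain z where z: "z \<in> H" "z \<noteq> x" "z \<noteq> y" using sub by blast
  have "\<phi> {x, z} = 1 - \<phi> {y, z}"
    using assms(1) z \<open>H \<subseteq> X\<close> by (auto simp: critical_pair_def)
  moreover obtain c where "\<forall>e \<in> [H]\<^bsup>2\<^esup>. \<phi> e = c" using assms(2) by (auto simp: hom_def)
  then have "\<phi> {x, z} = c" "\<phi> {y, z} = c"
    using z sub by (auto simp: pair_in_nsets_iff)
  \<comment> \<open>On naturals \<open>1 - c\<close> is 1 for c = 0 and 0 otherwise, so c =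
    \<open>1 - c\<close> is impossible.\<close>
  ultimately show False by presburger
qed

text \<open>Only one inclusion is stated; exchanging the two colorings gives the other, once the
  pair is known to be critical for both.\<close>

lemma hom_mono_if_agree_off_pair:
  assumes "\<And>e. e \<noteq> {x, y} \<Longrightarrow> \<psi> e = \<phi> e" "critical_pair X \<phi> x y"
  shows "hom X \<phi> \<subseteq> hom X \<psi>"
proof
  fix H assume H: "H \<in> hom X \<phi>"
  then have "\<not> {x, y} \<subseteq> H" using critical_pair_not_subset_hom assms(2) by metis
  then have "\<psi> e = \<phi> e" if "e \<in> [H]\<^bsup>2\<^esup>" for e
    using that assms(1) by (auto simp: nsets_def)
  then show "H \<in> hom X \<psi>" using H by (auto simp: hom_def)
qed

text \<open>Criticality of {x, y} constrains only pairs with exactly one end in {x, y}, so it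
  survives recoloring {x, y} itself.\<close>

lemma critical_pair_cong:
  assumes "\<And>e. e \<noteq> {x, y} \<Longrightarrow> \<psi> e = \<phi> e" "critical_pair X \<phi> x y"
  shows "critical_pair X \<psi> x y"
proof -
  have "\<psi> {x, z} = \<phi> {x, z}" "\<psi> {y, z} = \<phi> {y, z}" if "z \<in> X - {x, y}" for z
    using that by (auto intro!: assms(1))
  then show ?thesis using assms(2) by (simp add: critical_pair_def)
qed

lemma critical_pair_imp_twin:
  assumes \<phi>: "\<phi> \<in> colorings X" and crit: "critical_pair X \<phi> x y"
  shows "\<exists>\<psi> \<in> colorings X. \<exists>x \<in> X. hom X \<phi> = hom X \<psi> \<and> \<phi> \<noteq> \<psi> \<and>
           col_restrict \<phi> (X - {x}) = col_restrict \<psi> (X - {x})"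
proof (intro bexI conjI)
  have xy: "x \<in> X" "y \<in> X" "x \<noteq> y" "{x, y} \<in> [X]\<^bsup>2\<^esup>"
    using crit by (auto simp: critical_pair_def pair_in_nsets_iff)
  let ?\<psi> = "\<phi>({x, y} := 1 - \<phi> {x, y})"
  show "?\<psi> \<in> colorings X" 
    using \<phi> xy coloring_values[OF \<phi> xy(1-3)]
    by (auto simp: colorings_def PiE_iff extensional_def)
  show "x \<in> X" by (rule xy)
  show "hom X \<phi> = hom X ?\<psi>"
  proof
    show "hom X \<phi> \<subseteq> hom X ?\<psi>"
      by (rule hom_mono_if_agree_off_pair[OF _ crit]) simp
    have "critical_pair X ?\<psi> x y"
      by (rule critical_pair_cong[OF _ crit]) simp
    then show "hom X ?\<psi> \<subseteq> hom X \<phi>"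
      by (rule hom_mono_if_agree_off_pair[rotated]) simp
  qed
  have "?\<psi> {x, y} \<noteq> \<phi> {x, y}" by simp presburger
  then show "\<phi> \<noteq> ?\<psi>" by metis
  \<comment> \<open>The only recolored pair contains x, so it disappears with x.\<close>
  show "col_restrict \<phi> (X - {x}) = col_restrict ?\<psi> (X - {x})"
    by (auto simp: col_restrict_def restrict_def fun_eq_iff nsets_def)
qed

lemma twin_imp_critical_pair:
  assumes \<phi>: "\<phi> \<in> colorings X" and \<psi>: "\<psi> \<in> colorings X" and x: "x \<in> X"
    and hom: "hom X \<phi> = hom X \<psi>" and ne: "\<phi> \<noteq> \<psi>"
    and agree: "col_restrict \<phi> (X - {x}) = col_restrict \<psi> (X - {x})"
  shows "\<exists>x y. critical_pair X \<phi> x y"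
proof -
  note val = coloring_values[OF \<phi>] coloring_values[OF \<psi>]
  have off: "\<phi> {a, b} = \<psi> {a, b}" if "a \<in> X" "b \<in> X" "a \<noteq> b" "a \<noteq> x" "b \<noteq> x" for a b
  proof -
    have "{a, b} \<in> [X - {x}]\<^bsup>2\<^esup>" using that by (auto simp: pair_in_nsets_iff)
    then show ?thesis using fun_cong[OF agree, of "{a, b}"] by (simp add: col_restrict_def)
  qed
  define D where "D = {y \<in> X - {x}. \<phi> {x, y} \<noteq> \<psi> {x, y}}"
  \<comment> \<open>Equality of \<open>hom\<close> at {x, a, b}; by \<open>off\<close> both
    colorings give {a, b} the color \<open>\<phi> {a, b}\<close>.\<close>
  have triangle: "(\<phi> {x, a} = \<phi> {x, b} \<and> \<phi> {x, a} = \<phi> {a, b}) \<longleftrightarrow>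
      (\<psi> {x, a} = \<psi> {x, b} \<and> \<psi> {x, a} = \<phi> {a, b})"
    if "a \<in> X" "b \<in> X" "a \<noteq> x" "b \<noteq> x" "a \<noteq> b" for a b
    using that x hom off[of a b] triple_in_hom_iff[of x X a b \<phi>] triple_in_hom_iff[of x X a b \<psi>]
    by auto
  \<comment> \<open>If {x, w} and {y, w} shared a color, exactly one of the two colorings would give
    it to {x, y} as well, and the triangle would be homogeneous for that one only.\<close>
  have out: "\<phi> {x, w} = 1 - \<phi> {y, w}" if "y \<in> D" "w \<in> X" "w \<noteq> x" "w \<noteq> y" "w \<notin> D" for y w
    using that triangle[of y w] val(1)[of x y] val(2)[of x y] val(1)[of x w] val(1)[of y w] x
    unfolding D_def by auto
  \<comment> \<open>If {x, y} and {x, z} agreed under \<open>\<phi>\<close>, they would both take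
    the opposite color under \<open>\<psi>\<close>; {y, z} matches exactly one of these
    colors.\<close>
  have inside: "\<phi> {x, y} \<noteq> \<phi> {x, z}" if "y \<in> D" "z \<in> D" "y \<noteq> z" for y z
    using that triangle[of y z] val(1)[of x y] val(2)[of x y] val(1)[of x z] val(2)[of x z]
      val(1)[of y z] x
    unfolding D_def by auto
  obtain e where e: "\<phi> e \<noteq> \<psi> e" using ne by blast
  \<comment> \<open>Outside [X]^2 both colorings take the value \<open>undefined\<close>.\<close>
  then have "e \<in> [X]\<^bsup>2\<^esup>"
    using \<phi> \<psi> unfolding colorings_def by (metis PiE_arb)
  then obtain a b where ab: "e = {a, b}" "a \<in> X" "b \<in> X" "a \<noteq> b" by (auto simp: nsets_2_eq)
  \<comment> \<open>By \<open>off\<close>, e contains x; its other end lies in D.\<close>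
  obtain y where "y \<in> D"
    using e ab off[of a b] by (cases "a = x"; cases "b = x") (auto simp: D_def insert_commute)
  then have y: "y \<in> X" "y \<noteq> x" by (auto simp: D_def)
  \<comment> \<open>Points outside D are settled by \<open>out\<close>, so only the other points of
    D remain to be checked.\<close>
  have crit: "critical_pair X \<phi> x u"
    if "u \<in> D" "\<And>w. w \<in> D \<Longrightarrow> w \<noteq> u \<Longrightarrow> \<phi> {x, w} = 1 - \<phi> {u, w}" for u
    using that out x unfolding critical_pair_def pair_in_nsets_iff D_def by blast
  show ?thesis
  proof (cases "D = {y}")
    case True
    then show ?thesis using crit[of y] by auto
  next
    case False
    then obtain z where "z \<in> D" "z \<noteq> y" using \<open>y \<in> D\<close> by blast
    then have z: "z \<in> X" "z \<noteq> x" by (auto simp: D_def)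
    have vals: "\<phi> {x, u} = 0 \<or> \<phi> {x, u} = 1" if "u \<in> D" for u
      using that val(1) x by (auto simp: D_def)
    \<comment> \<open>A third point w would give three pairwise distinct colors among 0 and
      1.\<close>
    have D: "w = y \<or> w = z" if "w \<in> D" for w
      using inside[of y z] inside[of y w] inside[of z w] vals[of y] vals[of z] vals[of w] that
        \<open>y \<in> D\<close> \<open>z \<in> D\<close> \<open>z \<noteq> y\<close> by metis
    \<comment> \<open>Since {x, y} and {x, z} carry the two different colors, {y, z} differs from
      one of them: from {x, z}, and x, y is critical, or from {x, y}, and x, z is.\<close>
    have "\<phi> {x, z} = 1 - \<phi> {y, z} \<or> \<phi> {x, y} = 1 - \<phi> {z, y}"
      using inside[of y z] vals[of y] vals[of z] val(1)[of y z] y z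
        \<open>y \<in> D\<close> \<open>z \<in> D\<close> \<open>z \<noteq> y\<close> by (auto simp: insert_commute)
    then show ?thesis using crit[of y] crit[of z] D \<open>y \<in> D\<close> \<open>z \<in> D\<close> by metis
  qed
qed

theorem mainTheorem6:
  fixes X :: "'a set" and \<phi> :: "'a set \<Rightarrow> nat"
  assumes "countable X"
    and "infinite X \<or> card X \<ge> 3"
    and "\<phi> \<in> colorings X"
  shows "(\<exists>\<psi> \<in> colorings X. \<exists>x \<in> X.
            hom X \<phi> = hom X \<psi> \<and> \<phi> \<noteq> \<psi> \<and>
            col_restrict \<phi> (X - {x}) = col_restrict \<psi> (X - {x}))
         \<longleftrightarrow> (\<exists>x y. critical_pair X \<phi> x y)"
  using critical_pair_imp_twin twin_imp_critical_pair assms(3) by metis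

end
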